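(* Let $P,Q,b_0,b_1\in\mathbb C$ and let $x,y,z:\mathbb Z^2\to\mathbb C$ satisfy the C3 lattice system at every lattice point: $$y_{1,0}z_{0,0}=x_{1,0}-x_{0,0},\qquad y_{0,1}z_{0,0}=x_{0,1}-x_{0,0},$$ $$z_{1,1}y_{0,0}=b_0x_{0,0}+b_1+z_{0,0}\,\frac{P\,y_{1,0}z_{0,1}-Q\,y_{0,1}z_{1,0}}{z_{1,0}-z_{0,1}},$$ where $y$ and $z$ vanish nowhere and $z_{1,0}\neq z_{0,1}$, $y_{1,0}\ne y_{0,1}$ at every lattice point. Then $y$ satisfies, at every lattice point, the one-component equation (independent of $b_0,b_1$) $$\left(\frac{P\,y_{1,1}-Q\,y_{0,2}}{y_{0,2}-y_{1,1}}\right)\frac{y_{1,2}}{y_{0,1}}-\left(\frac{P\,y_{2,0}-Q\,y_{1,1}}{y_{1,1}-y_{2,0}}\right)\frac{y_{2,1}}{y_{1,0}}=\frac{y_{0,0}}{y_{1,0}}-\frac{y_{0,0}}{y_{0,1}}-\frac{y_{1,2}}{y_{2,2}}+\frac{y_{2,1}}{y_{2,2}} .$$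
   Context: For a function $u$ on $\mathbb Z^2$ and a generic base point $(n,m)$, $u_{\nu,\mu}$ denotes $u(n+\nu,m+\mu)$; an equation "holds at every lattice point" if it holds for every $(n,m)\in\mathbb Z^2$. *)

theory Defs
  imports Complex_Main
begin

text \<open>Functions on the lattice \<open>\<int> \<times> \<int>\<close> are curried: \<open>u n m\<close> is the value of \<open>u\<close> at \<open>(n, m)\<close>.\<close>

definition C3_lattice_system ::
  "complex \<Rightarrow> complex \<Rightarrow> complex \<Rightarrow> complex \<Rightarrow> (int \<Rightarrow> int \<Rightarrow> complex) \<Rightarrow>
    (int \<Rightarrow> int \<Rightarrow> complex) \<Rightarrow> (int \<Rightarrow> int \<Rightarrow> complex) \<Rightarrow> bool" where
  "C3_lattice_system P Q b0 b1 x y z \<longleftrightarrow>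
    (\<forall>n m.
      y (n + 1) m * z n m = x (n + 1) m - x n m \<and>
      y n (m + 1) * z n m = x n (m + 1) - x n m \<and>
      z (n + 1) (m + 1) * y n m =
        b0 * x n m + b1 +
        z n m * ((P * y (n + 1) m * z n (m + 1) - Q * y n (m + 1) * z (n + 1) m)
                 / (z (n + 1) m - z n (m + 1))))"

definition C3_y_equation ::
  "complex \<Rightarrow> complex \<Rightarrow> (int \<Rightarrow> int \<Rightarrow> complex) \<Rightarrow> bool" where
  "C3_y_equation P Q y \<longleftrightarrow>
    (\<forall>n m.
      ((P * y (n + 1) (m + 1) - Q * y n (m + 2)) / (y n (m + 2) - y (n + 1) (m + 1)))
          * (y (n + 1) (m + 2) / y n (m + 1))
      - ((P * y (n + 2) m - Q * y (n + 1) (m + 1)) / (y (n + 1) (m + 1) - y (n + 2) m))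
          * (y (n + 2) (m + 1) / y (n + 1) m)
      = y n m / y (n + 1) m - y n m / y n (m + 1)
        - y (n + 1) (m + 2) / y (n + 2) (m + 2) + y (n + 2) (m + 1) / y (n + 2) (m + 2))"

end

theory Submission
  imports Defs
begin

text \<open>
  Commuting shifts of \<open>x\<close> give \<open>z\<^sub>0\<^sub>0 (y\<^sub>1\<^sub>0 - y\<^sub>0\<^sub>1) = y\<^sub>1\<^sub>1 (z\<^sub>0\<^sub>1 - z\<^sub>1\<^sub>0)\<close>, which turns the third equation
  into \<open>z\<^sub>1\<^sub>1 y\<^sub>0\<^sub>0 = b\<^sub>0 x\<^sub>0\<^sub>0 + b\<^sub>1 + A\<^sub>0\<^sub>0\<close> with
  \<open>A\<^sub>0\<^sub>0 = y\<^sub>1\<^sub>1 (P y\<^sub>1\<^sub>0 z\<^sub>0\<^sub>1 - Q y\<^sub>0\<^sub>1 z\<^sub>1\<^sub>0) / (y\<^sub>0\<^sub>1 - y\<^sub>1\<^sub>0)\<close>.  The differences of this equation along the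
  two lattice directions contain \<open>b\<^sub>0 y\<^sub>1\<^sub>0 z\<^sub>0\<^sub>0\<close> and \<open>b\<^sub>0 y\<^sub>0\<^sub>1 z\<^sub>0\<^sub>0\<close>, so a combination of them
  is free of \<open>b\<^sub>0\<close> and \<open>b\<^sub>1\<close>.  In that combination the terms with \<open>z\<^sub>1\<^sub>0\<close> and \<open>z\<^sub>0\<^sub>1\<close>
  cancel, and what remains is a multiple of \<open>z\<^sub>1\<^sub>1\<close>.
\<close>

lemma lattice_compatibility:
  fixes x y z :: "int \<Rightarrow> int \<Rightarrow> 'a :: comm_ring"
  assumes "\<And>n m. y (n + 1) m * z n m = x (n + 1) m - x n m"
    and "\<And>n m. y n (m + 1) * z n m = x n (m + 1) - x n m"
  shows "z n m * (y (n + 1) m - y n (m + 1)) =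
    y (n + 1) (m + 1) * (z n (m + 1) - z (n + 1) m)"
proof -
  have "z n m * (y (n + 1) m - y n (m + 1)) = y (n + 1) m * z n m - y n (m + 1) * z n m"
    by (simp add: algebra_simps)
  also have "\<dots> = x (n + 1) m - x n (m + 1)"
    using assms(1)[of n m] assms(2)[of n m] by simp
  also have "\<dots> = y (n + 1) (m + 1) * z n (m + 1) - y (n + 1) (m + 1) * z (n + 1) m"
    using assms(1)[of n "m + 1"] assms(2)[of "n + 1" m] by simp
  finally show ?thesis
    by (simp add: right_diff_distrib)
qed

theorem mainTheorem4:
  fixes P Q b0 b1 :: complex
    and x y z :: "int \<Rightarrow> int \<Rightarrow> complex"
  assumes "C3_lattice_system P Q b0 b1 x y z"
    and "\<And>n m. y n m \<noteq> 0"
    and "\<And>n m. z n m \<noteq> 0"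
    and "\<And>n m. z (n + 1) m \<noteq> z n (m + 1)"
    and "\<And>n m. y (n + 1) m \<noteq> y n (m + 1)"
  shows "C3_y_equation P Q y"
proof -
  note nz = assms(2,3)
  have x1: "y (n + 1) m * z n m = x (n + 1) m - x n m"
    and x2: "y n (m + 1) * z n m = x n (m + 1) - x n m"
    and third: "z (n + 1) (m + 1) * y n m = b0 * x n m + b1 +
        z n m * ((P * y (n + 1) m * z n (m + 1) - Q * y n (m + 1) * z (n + 1) m)
                 / (z (n + 1) m - z n (m + 1)))" for n m
    using assms(1) unfolding C3_lattice_system_def by blast+
  note comp = lattice_compatibility[of y z x, OF x1 x2]
  define A where "A n m = y (n + 1) (m + 1) *
    (P * y (n + 1) m * z n (m + 1) - Q * y n (m + 1) * z (n + 1) m) / (y n (m + 1) - y (n + 1) m)"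
    for n m
  have A_mult: "A n m * (y n (m + 1) - y (n + 1) m) =
    y (n + 1) (m + 1) * (P * y (n + 1) m * z n (m + 1) - Q * y n (m + 1) * z (n + 1) m)" for n m
    using assms(5)[of n m] by (simp add: A_def)
  have quotient: "z n m / (z (n + 1) m - z n (m + 1)) =
    y (n + 1) (m + 1) / (y n (m + 1) - y (n + 1) m)" for n m
    using comp[of n m] assms(4)[of n m] assms(5)[of n m]
    by (simp add: frac_eq_eq algebra_simps)
  have third': "z (n + 1) (m + 1) * y n m = b0 * x n m + b1 + A n m" for n m
    using third[of n m] quotient[of n m] unfolding A_def
    by (metis times_divide_eq_left times_divide_eq_right)
  have "((P * y (n + 1) (m + 1) - Q * y n (m + 2)) / (y n (m + 2) - y (n + 1) (m + 1)))
          * (y (n + 1) (m + 2) / y n (m + 1))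
      - ((P * y (n + 2) m - Q * y (n + 1) (m + 1)) / (y (n + 1) (m + 1) - y (n + 2) m))
          * (y (n + 2) (m + 1) / y (n + 1) m)
      = y n m / y (n + 1) m - y n m / y n (m + 1)
        - y (n + 1) (m + 2) / y (n + 2) (m + 2) + y (n + 2) (m + 1) / y (n + 2) (m + 2)" for n m
  proof -
    let ?y00 = "y n m" and ?y10 = "y (n + 1) m" and ?y01 = "y n (m + 1)"
      and ?y20 = "y (n + 2) m" and ?y11 = "y (n + 1) (m + 1)" and ?y02 = "y n (m + 2)"
      and ?y21 = "y (n + 2) (m + 1)" and ?y12 = "y (n + 1) (m + 2)" and ?y22 = "y (n + 2) (m + 2)"
      and ?z10 = "z (n + 1) m" and ?z01 = "z n (m + 1)" and ?z20 = "z (n + 2) m"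
      and ?z11 = "z (n + 1) (m + 1)" and ?z02 = "z n (m + 2)"
      and ?z21 = "z (n + 2) (m + 1)" and ?z12 = "z (n + 1) (m + 2)"
    have [simp]: "n + 1 + 1 = n + 2" "m + 1 + 1 = m + 2" by simp_all
    define L1 where "L1 = (P * ?y11 - Q * ?y02) / (?y02 - ?y11)"
    define L2 where "L2 = (P * ?y20 - Q * ?y11) / (?y11 - ?y20)"
    have d1: "?y02 - ?y11 \<noteq> 0" and d2: "?y11 - ?y20 \<noteq> 0"
      using assms(5)[of n "m + 1"] assms(5)[of "n + 1" m] by auto
    have L1: "L1 * (?y02 - ?y11) = P * ?y11 - Q * ?y02"
      and L2: "L2 * (?y11 - ?y20) = P * ?y20 - Q * ?y11"
      using d1 d2 by (simp_all add: L1_def L2_def)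
    have c10: "?z10 * (?y20 - ?y11) = ?y21 * (?z11 - ?z20)"
      and c01: "?z01 * (?y11 - ?y02) = ?y12 * (?z02 - ?z11)"
      and c11: "?z11 * (?y21 - ?y12) = ?y22 * (?z12 - ?z21)"
      using comp[of "n + 1" m] comp[of n "m + 1"] comp[of "n + 1" "m + 1"] by simp_all
    \<comment> \<open>Here \<open>c10\<close> eliminates \<open>?z20\<close>, so that only
      \<open>?z11\<close> and \<open>?z10\<close> remain.\<close>
    have "A (n + 1) m * (?y11 - ?y20) = (?y21 * ?z11 * L2 - Q * ?y11 * ?z10) * (?y11 - ?y20)"
      using A_mult[of "n + 1" m] c10 L2 by simp algebra
    then have A10: "A (n + 1) m = ?y21 * ?z11 * L2 - Q * ?y11 * ?z10"
      using d2 by simp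
    have "A n (m + 1) * (?y02 - ?y11) = (?y12 * ?z11 * L1 - P * ?y11 * ?z01) * (?y02 - ?y11)"
      using A_mult[of n "m + 1"] c01 L1 by simp algebra
    then have A01: "A n (m + 1) = ?y12 * ?z11 * L1 - P * ?y11 * ?z01"
      using d1 by simp
    have t: "?z21 * ?y10 = b0 * x (n + 1) m + b1 + A (n + 1) m"
      "?z12 * ?y01 = b0 * x n (m + 1) + b1 + A n (m + 1)"
      using third'[of "n + 1" m] third'[of n "m + 1"] by simp_all
    \<comment> \<open>Both sides equal \<open>b0 * ?y10 * ?y01 * z n m\<close>.\<close>
    have b_free: "?y01 * (?z21 * ?y10 - ?z11 * ?y00 - A (n + 1) m + A n m) =
      ?y10 * (?z12 * ?y01 - ?z11 * ?y00 - A n (m + 1) + A n m)"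
      using t third'[of n m] x1[of n m] x2[of n m] by algebra
    \<comment> \<open>The net weight of \<open>A n m\<close> in \<open>b_free\<close> is
      \<open>?y01 - ?y10\<close>, so \<open>A_mult\<close> cancels the \<open>?z10\<close> and
      \<open>?z01\<close> terms of \<open>A10\<close> and \<open>A01\<close>. The factor
      \<open>?y22\<close> lets \<open>c11\<close> turn \<open>?z21 - ?z12\<close> into a multiple of
      \<open>?z11\<close>.\<close>
    have "?z11 * (?y22 * (?y10 * ?y12 * L1 - ?y01 * ?y21 * L2)) =
      ?z11 * (?y22 * ?y00 * (?y01 - ?y10) + ?y01 * ?y10 * (?y21 - ?y12))"
      using b_free A10 A01 A_mult[of n m] c11 by algebra
    then have y_eq: "?y22 * (?y10 * ?y12 * L1 - ?y01 * ?y21 * L2) =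
      ?y22 * ?y00 * (?y01 - ?y10) + ?y01 * ?y10 * (?y21 - ?y12)"
      using nz by simp
    have "?y10 * inverse ?y10 = 1" "?y01 * inverse ?y01 = 1" "?y22 * inverse ?y22 = 1"
      using nz by simp_all
    with y_eq have "L1 * (?y12 / ?y01) - L2 * (?y21 / ?y10) =
      ?y00 / ?y10 - ?y00 / ?y01 - ?y12 / ?y22 + ?y21 / ?y22"
      unfolding divide_inverse by algebra
    then show ?thesis
      unfolding L1_def L2_def .
  qed
  then show ?thesis
    unfolding C3_y_equation_def by blast
qed

end
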